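(* Let $a_1,a_2,a_3$ be distinct non-null points with quadrances $q_1\equiv q(a_2,a_3)$, $q_2\equiv q(a_1,a_3)$, $q_3\equiv q(a_1,a_2)$. If the lines $a_1a_3$ and $a_2a_3$ are perpendicular, then $$q_3=q_1+q_2-q_1q_2.$$
   Context: Let $\mathbb F$ be a field of characteristic not two. A 3-proportion $x:y:z$ is a triple of elements of $\mathbb F$, not all zero, up to a common non-zero scalar. A point $a=[x:y:z]$ and a line $L=(l:m:n)$ are both 3-proportions. The point $[x:y:z]$ lies on the line $(l:m:n)$ when $lx+my-nz=0$. For distinct points $a,b$, the join $ab$ is the unique line through both. A point $[x:y:z]$ is null when $x^2+y^2-z^2=0$. Lines $(l_1:m_1:n_1)$ and $(l_2:m_2:n_2)$ are perpendicular when $l_1l_2+m_1m_2-n_1n_2=0$. The quadrance between non-null points $a_1=[x_1:y_1:z_1]$ and $a_2=[x_2:y_2:z_2]$ is $$q(a_1,a_2)=1-\frac{(x_1x_2+y_1y_2-z_1z_2)^2}{(x_1^2+y_1^2-z_1^2)(x_2^2+y_2^2-z_2^2)};$$ it is undefined if either point is null. *)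

theory Defs
  imports Main
begin

fun prop_rel :: "'a::field \<times> 'a \<times> 'a \<Rightarrow> 'a \<times> 'a \<times> 'a \<Rightarrow> bool" where
  "prop_rel (x, y, z) (x', y', z') \<longleftrightarrow>
     (x, y, z) \<noteq> (0, 0, 0) \<and> (\<exists>c. c \<noteq> 0 \<and> x' = c * x \<and> y' = c * y \<and> z' = c * z)"

lemma part_equivp_prop_rel: "part_equivp (prop_rel :: 'a::field \<times> 'a \<times> 'a \<Rightarrow> _)"
proof (rule part_equivpI)
  have "prop_rel (1, 0, 0) (1, 0, 0 :: 'a)" by (auto intro!: exI[of _ 1])
  then show "\<exists>t. prop_rel t (t :: 'a \<times> 'a \<times> 'a)" by blast
next
  show "symp (prop_rel :: 'a \<times> 'a \<times> 'a \<Rightarrow> _)"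
  proof (rule sympI)
    fix s t :: "'a \<times> 'a \<times> 'a"
    assume *: "prop_rel s t"
    obtain x y z x' y' z' where s: "s = (x, y, z)" and t: "t = (x', y', z')"
      by (metis prod_cases3)
    from * obtain c where "c \<noteq> 0" "x' = c * x" "y' = c * y" "z' = c * z" "s \<noteq> (0, 0, 0)"
      unfolding s t by auto
    then show "prop_rel t s"
      unfolding s t by (auto intro!: exI[of _ "inverse c"])
  qed
next
  show "transp (prop_rel :: 'a \<times> 'a \<times> 'a \<Rightarrow> _)"
  proof (rule transpI)
    fix r s t :: "'a \<times> 'a \<times> 'a"
    assume *: "prop_rel r s" "prop_rel s t"
    obtain x y z x' y' z' x'' y'' z''
      where r: "r = (x, y, z)" and s: "s = (x', y', z')" and t: "t = (x'', y'', z'')"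
      by (metis prod_cases3)
    from * obtain c d where
      "c \<noteq> 0" "x' = c * x" "y' = c * y" "z' = c * z" "r \<noteq> (0, 0, 0)"
      "d \<noteq> 0" "x'' = d * x'" "y'' = d * y'" "z'' = d * z'"
      unfolding r s t by auto
    then show "prop_rel r t"
      unfolding r s t by (auto intro!: exI[of _ "d * c"])
  qed
qed

quotient_type (overloaded) 'a proportion = "'a::field \<times> 'a \<times> 'a" / partial: prop_rel
  by (rule part_equivp_prop_rel)

type_synonym 'a point = "'a proportion"
type_synonym 'a line = "'a proportion"

lift_definition on_line :: "'a::field point \<Rightarrow> 'a line \<Rightarrow> bool" is
  "\<lambda>(x, y, z) (l, m, n). l * x + m * y - n * z = 0"
proof -
  fix s t u v :: "'a \<times> 'a \<times> 'a"
  assume *: "prop_rel s t" "prop_rel u v"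
  obtain x y z x' y' z' l m n l' m' n'
    where e: "s = (x, y, z)" "t = (x', y', z')" "u = (l, m, n)" "v = (l', m', n')"
    by (metis prod_cases3)
  from * obtain c d where h: "c \<noteq> 0" "x' = c * x" "y' = c * y" "z' = c * z"
      "d \<noteq> 0" "l' = d * l" "m' = d * m" "n' = d * n"
    unfolding e by auto
  have "l' * x' + m' * y' - n' * z' = (c * d) * (l * x + m * y - n * z)"
    unfolding h by (simp add: algebra_simps)
  then show "(case s of (x, y, z) \<Rightarrow> \<lambda>(l, m, n). l * x + m * y - n * z = 0) u =
      (case t of (x, y, z) \<Rightarrow> \<lambda>(l, m, n). l * x + m * y - n * z = 0) v"
    using h(1,5) unfolding e by (simp del: right_minus_eq)
qed

lift_definition null_point :: "'a::field point \<Rightarrow> bool" is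
  "\<lambda>(x, y, z). x^2 + y^2 - z^2 = 0"
proof -
  fix s t :: "'a \<times> 'a \<times> 'a"
  assume *: "prop_rel s t"
  obtain x y z x' y' z' where e: "s = (x, y, z)" "t = (x', y', z')"
    by (metis prod_cases3)
  from * obtain c where h: "c \<noteq> 0" "x' = c * x" "y' = c * y" "z' = c * z"
    unfolding e by auto
  have "x'^2 + y'^2 - z'^2 = c^2 * (x^2 + y^2 - z^2)"
    unfolding h by (simp add: algebra_simps power2_eq_square)
  then show "(case s of (x, y, z) \<Rightarrow> x^2 + y^2 - z^2 = 0) =
      (case t of (x, y, z) \<Rightarrow> x^2 + y^2 - z^2 = 0)"
    using h(1) unfolding e by (simp del: right_minus_eq)
qed

lift_definition perpendicular :: "'a::field line \<Rightarrow> 'a line \<Rightarrow> bool" is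
  "\<lambda>(l1, m1, n1) (l2, m2, n2). l1 * l2 + m1 * m2 - n1 * n2 = 0"
proof -
  fix s t u v :: "'a \<times> 'a \<times> 'a"
  assume *: "prop_rel s t" "prop_rel u v"
  obtain x y z x' y' z' l m n l' m' n'
    where e: "s = (x, y, z)" "t = (x', y', z')" "u = (l, m, n)" "v = (l', m', n')"
    by (metis prod_cases3)
  from * obtain c d where h: "c \<noteq> 0" "x' = c * x" "y' = c * y" "z' = c * z"
      "d \<noteq> 0" "l' = d * l" "m' = d * m" "n' = d * n"
    unfolding e by auto
  have "x' * l' + y' * m' - z' * n' = (c * d) * (x * l + y * m - z * n)"
    unfolding h by (simp add: algebra_simps)
  then show "(case s of (l1, m1, n1) \<Rightarrow> \<lambda>(l2, m2, n2). l1 * l2 + m1 * m2 - n1 * n2 = 0) u =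
      (case t of (l1, m1, n1) \<Rightarrow> \<lambda>(l2, m2, n2). l1 * l2 + m1 * m2 - n1 * n2 = 0) v"
    using h(1,5) unfolding e by (simp del: right_minus_eq)
qed

(* For a null argument the denominator vanishes and, as x / 0 = 0, the value is 1;
   mathematically the quadrance is undefined there. *)
lift_definition quadrance :: "'a::field point \<Rightarrow> 'a point \<Rightarrow> 'a" is
  "\<lambda>(x1, y1, z1) (x2, y2, z2).
     1 - (x1 * x2 + y1 * y2 - z1 * z2)^2 /
         ((x1^2 + y1^2 - z1^2) * (x2^2 + y2^2 - z2^2))"
proof -
  fix s t u v :: "'a \<times> 'a \<times> 'a"
  assume *: "prop_rel s t" "prop_rel u v"
  obtain x y z x' y' z' l m n l' m' n'
    where e: "s = (x, y, z)" "t = (x', y', z')" "u = (l, m, n)" "v = (l', m', n')"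
    by (metis prod_cases3)
  from * obtain c d where h: "c \<noteq> 0" "x' = c * x" "y' = c * y" "z' = c * z"
      "d \<noteq> 0" "l' = d * l" "m' = d * m" "n' = d * n"
    unfolding e by auto
  have "(x' * l' + y' * m' - z' * n')^2 = (c * d)^2 * (x * l + y * m - z * n)^2"
    unfolding h by (simp add: algebra_simps power2_eq_square)
  moreover have "(x'^2 + y'^2 - z'^2) * (l'^2 + m'^2 - n'^2) =
      (c * d)^2 * ((x^2 + y^2 - z^2) * (l^2 + m^2 - n^2))"
    unfolding h by (simp add: algebra_simps power2_eq_square)
  ultimately show "(case s of (x1, y1, z1) \<Rightarrow> \<lambda>(x2, y2, z2).
      1 - (x1 * x2 + y1 * y2 - z1 * z2)^2 / ((x1^2 + y1^2 - z1^2) * (x2^2 + y2^2 - z2^2))) u =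
      (case t of (x1, y1, z1) \<Rightarrow> \<lambda>(x2, y2, z2).
      1 - (x1 * x2 + y1 * y2 - z1 * z2)^2 / ((x1^2 + y1^2 - z1^2) * (x2^2 + y2^2 - z2^2))) v"
    using h(1,5) unfolding e by simp
qed

(* Meaningful only for a \<noteq> b; see ex1_join below. *)
definition join :: "'a::field point \<Rightarrow> 'a point \<Rightarrow> 'a line" where
  "join a b = (THE L. on_line a L \<and> on_line b L)"

lemma prop_relI_cross:
  fixes x y z x' y' z' :: "'a::field"
  assumes nz: "(x, y, z) \<noteq> (0, 0, 0)" "(x', y', z') \<noteq> (0, 0, 0)"
    and cr: "y * z' = z * y'" "z * x' = x * z'" "x * y' = y * x'"
  shows "prop_rel (x, y, z) (x', y', z')"
proof -
  have "x \<noteq> 0 \<or> y \<noteq> 0 \<or> z \<noteq> 0" using nz by auto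
  then have "\<exists>c. x' = c * x \<and> y' = c * y \<and> z' = c * z"
  proof (elim disjE)
    assume "x \<noteq> 0"
    then show ?thesis using cr by (intro exI[of _ "x' / x"]) (simp add: nonzero_eq_divide_eq mult_ac)
  next
    assume "y \<noteq> 0"
    then show ?thesis using cr by (intro exI[of _ "y' / y"]) (simp add: nonzero_eq_divide_eq mult_ac)
  next
    assume "z \<noteq> 0"
    then show ?thesis using cr by (intro exI[of _ "z' / z"]) (simp add: nonzero_eq_divide_eq mult_ac)
  qed
  then obtain c where c: "x' = c * x" "y' = c * y" "z' = c * z" by blast
  then have "c \<noteq> 0" using nz(2) by auto
  then show ?thesis unfolding prop_rel.simps using c nz(1) by blast
qed

lemma prop_rel_nonzero: "prop_rel s s \<Longrightarrow> s \<noteq> (0, 0, 0)"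
  by auto

lemma ex_unique_line:
  fixes a b :: "'a::field point"
  assumes "a \<noteq> b"
  shows "\<exists>L. on_line a L \<and> on_line b L \<and> (\<forall>L'. on_line a L' \<and> on_line b L' \<longrightarrow> L' = L)"
  using assms
proof transfer
  fix s t :: "'a \<times> 'a \<times> 'a"
  assume st: "prop_rel s s" "prop_rel t t" "\<not> prop_rel s t"
  obtain x y z x' y' z' where e: "s = (x, y, z)" "t = (x', y', z')"
    by (metis prod_cases3)
  define l m n where "l = y * z' - z * y'" and "m = z * x' - x * z'" and "n = y * x' - x * y'"
  note lmn = this
  have nz: "(l, m, n) \<noteq> (0, 0, 0)"
    using prop_relI_cross[of x y z x' y' z'] st prop_rel_nonzero[OF st(1)] prop_rel_nonzero[OF st(2)]
    unfolding e lmn by (metis prod.inject eq_iff_diff_eq_0)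
  have on: "l * x + m * y - n * z = 0" "l * x' + m * y' - n * z' = 0"
    unfolding lmn by (simp_all add: algebra_simps)
  have unique: "prop_rel (p, q, r) (l, m, n)"
    if "prop_rel (p, q, r) (p, q, r)"
      and h: "p * x + q * y - r * z = 0" "p * x' + q * y' - r * z' = 0" for p q r
  proof (rule prop_relI_cross[OF prop_rel_nonzero[OF that(1)] nz])
    have "q * n - r * m = x' * (p * x + q * y - r * z) - x * (p * x' + q * y' - r * z')"
      "r * l - p * n = y' * (p * x + q * y - r * z) - y * (p * x' + q * y' - r * z')"
      "p * m - q * l = z * (p * x' + q * y' - r * z') - z' * (p * x + q * y - r * z)"
      unfolding lmn by (simp_all add: algebra_simps)
    then show "q * n = r * m" "r * l = p * n" "p * m = q * l"
      unfolding h by simp_all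
  qed
  have refl: "prop_rel (l, m, n) (l, m, n)"
    by (rule prop_relI_cross[OF nz nz]) (simp_all add: mult.commute)
  let ?on = "\<lambda>(x, y, z) (l, m, n). l * x + m * y - n * z = (0 :: 'a)"
  show "\<exists>L\<in>{x. prop_rel x x}. ?on s L \<and> ?on t L \<and>
      (\<forall>L'\<in>{x. prop_rel x x}. ?on s L' \<and> ?on t L' \<longrightarrow> prop_rel L' L)"
  proof (intro bexI[of _ "(l, m, n)"] conjI ballI impI)
    fix L' :: "'a \<times> 'a \<times> 'a"
    assume L': "L' \<in> {x. prop_rel x x}" "?on s L' \<and> ?on t L'"
    obtain p q r where w: "L' = (p, q, r)" by (metis prod_cases3)
    have "prop_rel L' L'" using L'(1) by (rule CollectD)
    then show "prop_rel L' (l, m, n)"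
      using unique[of p q r] L'(2) unfolding e w
      by (simp only: prod.case)
  qed (use on refl in \<open>simp_all only: e prod.case mem_Collect_eq\<close>)
qed

lemma ex1_join:
  fixes a b :: "'a::field point"
  assumes "a \<noteq> b"
  shows "\<exists>!L. on_line a L \<and> on_line b L"
  using ex_unique_line[OF assms] by metis

lemma on_line_join:
  fixes a b :: "'a::field point"
  assumes "a \<noteq> b"
  shows "on_line a (join a b)" "on_line b (join a b)"
  using theI'[OF ex1_join[OF assms]] unfolding join_def by blast+

end

(* Write a \<cdot> b for the bilinear form x x' + y y' - z z'. The join of two distinct points is
   proportional to their cross product (up to the sign convention for z), and by the Lagrange
   identity perpendicularity of a1 a3 and a2 a3 says (a1 \<cdot> a2) (a3 \<cdot> a3) = (a1 \<cdot> a3) (a2 \<cdot> a3).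
   Squaring and dividing gives 1 - q3 = (1 - q1) (1 - q2). *)
theory Submission
  imports Defs
begin

text \<open>Up to the sign of \<open>n\<close>, incidence says that the line is orthogonal to both
  triples, hence parallel to their cross product, which is nonzero because the points are
  distinct.\<close>

lemma line_through_points_cross:
  fixes x y z x' y' z' l m n :: "'a::field"
  assumes nz: "(x, y, z) \<noteq> (0, 0, 0)" "(x', y', z') \<noteq> (0, 0, 0)" "(l, m, n) \<noteq> (0, 0, 0)"
    and distinct: "\<not> prop_rel (x, y, z) (x', y', z')"
    and on: "l * x + m * y - n * z = 0" "l * x' + m * y' - n * z' = 0"
  obtains k where "y * z' - z * y' = k * l" "z * x' - x * z' = k * m" "y * x' - x * y' = k * n"
proof -
  let ?C = "(y * z' - z * y', z * x' - x * z', y * x' - x * y')"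
  have "?C \<noteq> (0, 0, 0)"
    using prop_relI_cross[OF nz(1,2)] distinct by (metis prod.inject eq_iff_diff_eq_0)
  \<comment> \<open>The cross product of \<open>(l, m, n)\<close> and \<open>?C\<close>, expanded as
    a vector triple product: every term contains an incidence form, so it vanishes.\<close>
  moreover have "m * (y * x' - x * y') - n * (z * x' - x * z')
        = x' * (l * x + m * y - n * z) - x * (l * x' + m * y' - n * z')"
      "n * (y * z' - z * y') - l * (y * x' - x * y')
        = y' * (l * x + m * y - n * z) - y * (l * x' + m * y' - n * z')"
      "l * (z * x' - x * z') - m * (y * z' - z * y')
        = z * (l * x' + m * y' - n * z') - z' * (l * x + m * y - n * z)"
    by (simp_all add: algebra_simps)
  ultimately have "prop_rel (l, m, n) ?C"
    using nz(3) on by (intro prop_relI_cross) simp_all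
  then show thesis
    using that by auto
qed

lemma perpendicular_lines_form_eq:
  fixes x1 y1 z1 x2 y2 z2 x3 y3 z3 :: "'a::field"
  assumes nz: "(x1, y1, z1) \<noteq> (0, 0, 0)" "(x2, y2, z2) \<noteq> (0, 0, 0)" "(x3, y3, z3) \<noteq> (0, 0, 0)"
      "(l, m, n) \<noteq> (0, 0, 0)" "(l', m', n') \<noteq> (0, 0, 0)"
    and distinct: "\<not> prop_rel (x1, y1, z1) (x3, y3, z3)" "\<not> prop_rel (x2, y2, z2) (x3, y3, z3)"
    and on: "l * x1 + m * y1 - n * z1 = 0" "l * x3 + m * y3 - n * z3 = 0"
      "l' * x2 + m' * y2 - n' * z2 = 0" "l' * x3 + m' * y3 - n' * z3 = 0"
    and perp: "l * l' + m * m' - n * n' = 0"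
  shows "(x1 * x2 + y1 * y2 - z1 * z2) * (x3^2 + y3^2 - z3^2)
    = (x1 * x3 + y1 * y3 - z1 * z3) * (x2 * x3 + y2 * y3 - z2 * z3)"
proof -
  obtain k where k: "y1 * z3 - z1 * y3 = k * l" "z1 * x3 - x1 * z3 = k * m" "y1 * x3 - x1 * y3 = k * n"
    using line_through_points_cross nz distinct on by metis
  obtain k' where k': "y2 * z3 - z2 * y3 = k' * l'" "z2 * x3 - x2 * z3 = k' * m'"
      "y2 * x3 - x2 * y3 = k' * n'"
    using line_through_points_cross nz distinct on by metis
  \<comment> \<open>Lagrange (Binet-Cauchy) identity for the indefinite form; its one minus sign
    reverses the order of the difference compared with the Euclidean case.\<close>
  have "(x1 * x3 + y1 * y3 - z1 * z3) * (x2 * x3 + y2 * y3 - z2 * z3)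
      - (x1 * x2 + y1 * y2 - z1 * z2) * (x3^2 + y3^2 - z3^2)
    = (y1 * z3 - z1 * y3) * (y2 * z3 - z2 * y3) + (z1 * x3 - x1 * z3) * (z2 * x3 - x2 * z3)
      - (y1 * x3 - x1 * y3) * (y2 * x3 - x2 * y3)"
    by (simp add: algebra_simps power2_eq_square)
  also have "\<dots> = k * k' * (l * l' + m * m' - n * n')"
    unfolding k k' by (simp add: algebra_simps)
  finally show ?thesis
    using perp by simp
qed

text \<open>Arbitrary incident lines replace \<open>join\<close>, a definite description, so that
  \<open>transfer\<close> reduces the claim to coordinates.\<close>

lemma quadrance_perpendicular_lines:
  fixes a1 a2 a3 :: "'a::field point"
  assumes "a1 \<noteq> a3" "a2 \<noteq> a3" "\<not> null_point a3"
    and "on_line a1 L" "on_line a3 L" "on_line a2 M" "on_line a3 M" "perpendicular L M"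
  shows "1 - quadrance a1 a2 = (1 - quadrance a2 a3) * (1 - quadrance a1 a3)"
  using assms
\<comment> \<open>Without these rules \<open>prop_rel\<close> stays folded and
  \<open>u - v = 0\<close> is not turned into \<open>u = v\<close>, which keeps the shape that
  \<open>perpendicular_lines_form_eq\<close> expects.\<close>
proof (transfer, clarsimp simp del: prop_rel.simps right_minus_eq)
  fix x1 y1 z1 x2 y2 z2 x3 y3 z3 l m n l' m' n' :: 'a
  assume refl: "prop_rel (x1, y1, z1) (x1, y1, z1)" "prop_rel (x2, y2, z2) (x2, y2, z2)"
      "prop_rel (x3, y3, z3) (x3, y3, z3)" "prop_rel (l, m, n) (l, m, n)"
      "prop_rel (l', m', n') (l', m', n')"
    and rest: "\<not> prop_rel (x1, y1, z1) (x3, y3, z3)" "\<not> prop_rel (x2, y2, z2) (x3, y3, z3)"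
      "l * x1 + m * y1 - n * z1 = 0" "l * x3 + m * y3 - n * z3 = 0"
      "l' * x2 + m' * y2 - n' * z2 = 0" "l' * x3 + m' * y3 - n' * z3 = 0"
      "l * l' + m * m' - n * n' = 0"
    and N3: "x3^2 + y3^2 - z3^2 \<noteq> 0"
  let ?N1 = "x1^2 + y1^2 - z1^2" and ?N2 = "x2^2 + y2^2 - z2^2" and ?N3 = "x3^2 + y3^2 - z3^2"
  let ?b12 = "x1 * x2 + y1 * y2 - z1 * z2" and ?b13 = "x1 * x3 + y1 * y3 - z1 * z3"
    and ?b23 = "x2 * x3 + y2 * y3 - z2 * z3"
  have eq: "?b12 * ?N3 = ?b13 * ?b23"
    by (rule perpendicular_lines_form_eq[OF refl[THEN prop_rel_nonzero] rest])
  have "?b23^2 / (?N2 * ?N3) * (?b13^2 / (?N1 * ?N3)) = (?b13 * ?b23)^2 / (?N1 * ?N2 * ?N3^2)"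
    by (simp only: times_divide_times_eq power_mult_distrib power2_eq_square mult_ac)
  also have "\<dots> = ?b12^2 * ?N3^2 / (?N1 * ?N2 * ?N3^2)"
    by (simp only: eq[symmetric] power_mult_distrib)
  \<comment> \<open>Only \<open>?N3\<close> is cancelled; should \<open>?N1 * ?N2\<close> be 0, both
    quotients are 0 by the convention for division by zero.\<close>
  also have "\<dots> = ?b12^2 / (?N1 * ?N2)"
    by (rule mult_divide_mult_cancel_right) (use N3 in \<open>simp del: right_minus_eq\<close>)
  finally show "?b12^2 / (?N1 * ?N2) = ?b23^2 * ?b13^2 / (?N2 * ?N3 * (?N1 * ?N3))"
    by (simp only: times_divide_times_eq)
qed

theorem theorem42:
  fixes a1 a2 a3 :: "'a::field point" and q1 q2 q3 :: 'a
  assumes "CHAR('a) \<noteq> 2"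
    and "a1 \<noteq> a2" and "a1 \<noteq> a3" and "a2 \<noteq> a3"
    and "\<not> null_point a1" and "\<not> null_point a2" and "\<not> null_point a3"
    and "q1 = quadrance a2 a3" and "q2 = quadrance a1 a3" and "q3 = quadrance a1 a2"
    and "perpendicular (join a1 a3) (join a2 a3)"
  shows "q3 = q1 + q2 - q1 * q2"
proof -
  \<comment> \<open>Multiplicative form of the claim, with the joins as incident lines; expanding
    the product finishes.\<close>
  have "1 - q3 = (1 - q1) * (1 - q2)"
    unfolding assms(8-10)
    by (rule quadrance_perpendicular_lines[OF assms(3,4,7) on_line_join[OF assms(3)]
        on_line_join[OF assms(4)] assms(11)])
  then show ?thesis
    by (simp add: algebra_simps)
qed

end
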